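(* Let $n \geq 4$ be an integer and let $\mathcal{C}_n$ be the Crown Subgraph with parameter $n$ described in the context. Let $G$ be a directed graph such that: (i) the vertex set of $G$ contains $\{1,\dots,5n-10\}$ together with at least one further vertex; (ii) the directed edges of $G$ with both endpoints in $\{1,\dots,5n-10\}$ are exactly the edges of $\mathcal{C}_n$; (iii) the directed edges of $G$ going from a vertex outside $\{1,\dots,5n-10\}$ to a vertex of $\{1,\dots,5n-10\}$ are exactly $n$ edges, called incoming edges and labelled $1,\dots,n$, where the incoming edge labelled $i$ has head $2i-1$ (for $i=1,\dots,n$); (iv) the directed edges of $G$ going from a vertex of $\{1,\dots,5n-10\}$ to a vertex outside it are exactly $n$ edges, called outgoing edges and labelled $1,\dots,n$, whose tails are: vertex $5n-10$ for label $1$; vertex $1$ for label $2$; vertex $2n-1$ for label $n-1$; vertex $2n$ for label $n$; vertex $5n-9-3i$ for label $i+2$, for each $i=1,\dots,\lfloor \frac{n-4}{2}\rfloor$; and vertex $2n-1+3i$ for label $n-1-i$, for each $i=1,\dots,\lceil \frac{n-4}{2}\rceil$. Then every (directed) Hamiltonian cycle of $G$ traverses exactly one incoming edge and exactly one outgoing edge, and these two edges have the same label. Furthermore, for each label $i$, there is only one path that a Hamiltonian cycle of $G$ using the incoming edge labelled $i$ can take through $\mathcal{C}_n$ between that incoming edge and the outgoing edge labelled $i$; i.e., any two Hamiltonian cycles of $G$ using the incoming edge labelled $i$ traverse the same directed path in $\mathcal{C}_n$.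
   Context: All graphs are directed; a Hamiltonian cycle is a directed cycle visiting every vertex exactly once. For an integer $n\ge 4$, the Crown Subgraph $\mathcal{C}_n$ is the directed graph on vertex set $\{1,2,\dots,5n-10\}$ with the following directed edges: $(i,i+1)$ and $(i+1,i)$ for all $i=1,\dots,5n-11$; $(1,5n-10)$ and $(5n-10,1)$; $(2n,2n-2)$ and $(5n-10,2)$; $(2n+3i,\,2n-2-2i)$ for all $i=1,\dots,\lceil \frac{n-4}{2}\rceil$; and $(5n-10-3i,\,2i+2)$ for all $i=1,\dots,\lfloor \frac{n-4}{2}\rfloor$. *)

theory Defs
  imports "Graph_Theory.Pair_Digraph"
begin

(* For n >= 4, (n - 3) div 2 is the ceiling of (n - 4)/2 and (n - 4) div 2 is its floor.
   In the ranges given, no natural-number subtraction below is truncated. *)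
definition crown :: "nat \<Rightarrow> nat pair_pre_digraph" where
  "crown n =
     \<lparr> pverts = {1..5*n - 10},
       parcs =
         (\<Union>i\<in>{1..5*n - 11}. {(i, i + 1), (i + 1, i)})
         \<union> {(1, 5*n - 10), (5*n - 10, 1)}
         \<union> {(2*n, 2*n - 2), (5*n - 10, 2)}
         \<union> {(2*n + 3*i, 2*n - 2 - 2*i) | i. i \<in> {1..(n - 3) div 2}}
         \<union> {(5*n - 10 - 3*i, 2*i + 2) | i. i \<in> {1..(n - 4) div 2}} \<rparr>"

(* A cycle already has pairwise distinct arc heads, so every vertex is visited exactly once. *)
definition (in pre_digraph) hamiltonian_cycle :: "'b awalk \<Rightarrow> bool" where
  "hamiltonian_cycle p \<longleftrightarrow> cycle p \<and> head G ` set p = verts G"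

(* A cycle is the list of its arcs from an arbitrary starting vertex; the rotation makes
   the notion "after e the cycle follows exactly q and then takes f" independent of that start. *)
definition follows_between :: "'b awalk \<Rightarrow> 'b \<Rightarrow> 'b awalk \<Rightarrow> 'b \<Rightarrow> bool" where
  "follows_between p e q f \<longleftrightarrow> (\<exists>k r. rotate k p = e # q @ f # r)"

end

(* Call 1..2n-1 the bottom and 2n..N, with N = 5n-10, the top. The bottom even vertices 2,...,2n-2
   have no outgoing edge and no chord out, so their successors in a Hamiltonian cycle are n-1 of the n
   bottom odd vertices, each a neighbour of its predecessor. Hence exactly one odd vertex 2m-1 is
   missed, it is the only possible head of an incoming edge, and the even vertices below it step
   down while those above it step up. So the cycle passes through the crown once.

   No chord enters the top, so along the top predecessors are ring neighbours, and a single used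
   chord forces the direction of every other top step. For m > floor(n/2) the passage must go
   2m-1, ..., 1, N, ..., t, then along the chord t -> 2m, then 2m+1, ..., t-1; for smaller m it is
   the mirror image. The alternative first step, up from 2m-1, would get stuck next to a
   chord tail at a vertex without outgoing edge. *)

theory Submission
  imports Defs
begin

section \<open>Arcs and exits of the crown\<close>

text \<open>Throughout, \<open>n = a + b + 4\<close>, where \<open>a\<close> and \<open>b\<close> count the chords of the two families other
  than \<open>(2n, 2n - 2)\<close> and \<open>(5n - 10, 2)\<close>; these two are the instances \<open>i = 0\<close> below. Leaving \<open>a\<close> and
  \<open>b\<close> independent makes the reflection of the crown, which exchanges them, available for every
  \<open>n\<close>; the crown itself has \<open>a = (n - 3) div 2\<close> and \<open>b = (n - 4) div 2\<close>.\<close>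

definition crown_arc :: "nat \<Rightarrow> nat \<Rightarrow> nat \<Rightarrow> nat \<Rightarrow> bool" where
  "crown_arc a b x y \<longleftrightarrow>
     y = Suc x \<or> x = Suc y \<or> (x = 1 \<and> y = 5*a + 5*b + 10) \<or> (x = 5*a + 5*b + 10 \<and> y = 1) \<or>
     (\<exists>i\<le>a. x = 2*a + 2*b + 8 + 3*i \<and> y + 2*i = 2*a + 2*b + 6) \<or>
     (\<exists>i\<le>b. x + 3*i = 5*a + 5*b + 10 \<and> y = 2*i + 2)"

text \<open>Tails of the outgoing edges, to be compared with \<open>crown_tail\<close>, which keeps
  the labels. For \<open>i \<ge> 1\<close> the reflection below exchanges the two families; at
  \<open>i = 0\<close> they give \<open>2n - 1\<close> and the non-vertex
  \<open>N + 1\<close>.\<close>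

definition crown_exit :: "nat \<Rightarrow> nat \<Rightarrow> nat \<Rightarrow> bool" where
  "crown_exit a b x \<longleftrightarrow>
     x = 1 \<or> x = 2*a + 2*b + 8 \<or> x = 5*a + 5*b + 10 \<or>
     (\<exists>i\<le>a. x = 2*a + 2*b + 7 + 3*i) \<or> (\<exists>i\<le>b. x + 3*i = 5*a + 5*b + 11)"

lemma crown_arc_even:
  assumes "crown_arc a b (2*j) y" "1 \<le> j" "j \<le> a + b + 3"
  shows "y = Suc (2*j) \<or> 2*j = Suc y"
  using assms by (auto simp: crown_arc_def)

lemma crown_exit_even:
  assumes "1 \<le> j" "j \<le> a + b + 3"
  shows "\<not> crown_exit a b (2*j)"
  using assms by (auto simp: crown_exit_def)

text \<open>For \<open>b + 3 \<le> m < n\<close>, the tail of the chord with head \<open>2m\<close>. For \<open>m = n\<close> there is none; the value \<open>2n\<close> then lets the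
  traversals for \<open>m < n\<close> and \<open>m = n\<close> share one formula.\<close>

definition chord_tail :: "nat \<Rightarrow> nat \<Rightarrow> nat" where
  "chord_tail n m = (if m = n then 2*n else 2*n + 3*(n - 1 - m))"

section \<open>Traversals of the crown\<close>

text \<open>A Hamiltonian path of the crown from \<open>2m - 1\<close> to an exit, given by the position of each vertex.\<close>

locale crown_traversal =
  fixes a b n N m :: nat and pos :: "nat \<Rightarrow> nat"
  assumes n: "n = a + b + 4" and N: "N = 5*a + 5*b + 10"
    and m: "1 \<le> m" "m \<le> n"
    and bij: "bij_betw pos {1..N} {..<N}"
    and start: "pos (2*m - 1) = 0"
    and steps: "\<And>x y. x \<in> {1..N} \<Longrightarrow> y \<in> {1..N} \<Longrightarrow> pos y = Suc (pos x) \<Longrightarrow> crown_arc a b x y"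
    and final: "\<And>x. x \<in> {1..N} \<Longrightarrow> Suc (pos x) = N \<Longrightarrow> crown_exit a b x"
begin

definition hop :: "nat \<Rightarrow> nat \<Rightarrow> bool" where
  "hop x y \<longleftrightarrow> x \<in> {1..N} \<and> y \<in> {1..N} \<and> pos y = Suc (pos x)"

lemma pos_inj: "x \<in> {1..N} \<Longrightarrow> y \<in> {1..N} \<Longrightarrow> pos x = pos y \<Longrightarrow> x = y"
  by (rule inj_onD[OF bij_betw_imp_inj_on[OF bij]])

lemma pos_less: "x \<in> {1..N} \<Longrightarrow> pos x < N"
  using bij_betwE[OF bij] by blast

lemma pos_surj: "k < N \<Longrightarrow> \<exists>x\<in>{1..N}. pos x = k"
proof -
  assume "k < N"
  then have "k \<in> pos ` {1..N}" using bij by (simp add: bij_betw_def)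
  then show ?thesis by auto
qed

lemma hop_arc: "hop x y \<Longrightarrow> crown_arc a b x y"
  using steps by (auto simp: hop_def)

lemma hop_pos: "hop x y \<Longrightarrow> pos y = Suc (pos x)"
  by (simp add: hop_def)

lemma hop_right_unique: "hop x y \<Longrightarrow> hop x z \<Longrightarrow> y = z"
  unfolding hop_def by (rule pos_inj) auto

lemma hop_left_unique: "hop x z \<Longrightarrow> hop y z \<Longrightarrow> x = y"
  unfolding hop_def by (rule pos_inj) auto

lemma hop_asym: "hop x y \<Longrightarrow> \<not> hop y x"
  unfolding hop_def by linarith

lemma ex_hop_from: "x \<in> {1..N} \<Longrightarrow> \<not> crown_exit a b x \<Longrightarrow> \<exists>y. hop x y"
proof -
  assume x: "x \<in> {1..N}" "\<not> crown_exit a b x"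
  then have "Suc (pos x) < N" using pos_less[of x] final[of x] by linarith
  then obtain y where "y \<in> {1..N}" "pos y = Suc (pos x)" using pos_surj by blast
  then show ?thesis using x by (auto simp: hop_def)
qed

text \<open>Only the start has no predecessor; \<open>Suc x \<noteq> 2*m\<close> excludes
  \<open>x = 2m - 1\<close> without truncated subtraction.\<close>

lemma ex_hop_to:
  assumes "1 \<le> x" "x \<le> N" "Suc x \<noteq> 2*m"
  shows "\<exists>y. hop y x"
proof -
  have x: "x \<in> {1..N}" "x \<noteq> 2*m - 1" using assms m by auto
  have "2*m - 1 \<in> {1..N}" using m n N by auto
  then have "pos x \<noteq> 0" using start pos_inj x by metis
  then obtain k where k: "pos x = Suc k" by (cases "pos x") auto
  then obtain y where "y \<in> {1..N}" "pos y = k" using pos_surj[of k] pos_less[OF x(1)] by auto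
  then show ?thesis using x k by (auto simp: hop_def)
qed

section \<open>Forced steps along the bottom\<close>

lemma no_pred_start: "\<not> hop x (2*m - 1)"
  using start by (simp add: hop_def)

text \<open>The lower neighbour of \<open>2m\<close> is the start, which is never entered again, and
  the lower neighbour of \<open>2(j + 1)\<close> is already entered from \<open>2j\<close>. So the
  upward direction propagates from \<open>m\<close>; \<open>even_down\<close> is the same argument
  running downwards.\<close>

lemma even_up: "m \<le> j \<Longrightarrow> j < n \<Longrightarrow> hop (2*j) (2*j + 1)"
proof (induction j rule: dec_induct)
  case base
  obtain y where y: "hop (2*m) y"
    using ex_hop_from[of "2*m"] crown_exit_even[of m a b] base m n N by auto
  have "y \<noteq> 2*m - 1" using no_pred_start y by auto
  with crown_arc_even[OF hop_arc[OF y]] base m n y show ?case by auto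
next
  case (step j)
  obtain y where y: "hop (2*Suc j) y"
    using ex_hop_from[of "2*Suc j"] crown_exit_even[of "Suc j" a b] step.prems m n N by auto
  have "y \<noteq> 2*j + 1"
    using hop_left_unique[of "2*Suc j" y "2*j"] y step by auto
  with crown_arc_even[OF hop_arc[OF y]] step.prems n y show ?case by auto
qed

lemma even_down: "1 \<le> j \<Longrightarrow> j < m \<Longrightarrow> hop (2*j) (2*j - 1)"
proof (induction "m - j" arbitrary: j rule: less_induct)
  case less
  obtain y where y: "hop (2*j) y"
    using ex_hop_from[of "2*j"] crown_exit_even[of j a b] less.prems m n N by auto
  have "y \<noteq> 2*j + 1"
  proof (cases "Suc j = m")
    case True
    then show ?thesis using no_pred_start[of "2*j"] y by auto
  next
    case False
    with less.prems have "hop (2*Suc j) (2*Suc j - 1)" by (intro less.hyps) auto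
    then show ?thesis using hop_left_unique[of "2*j" y "2*Suc j"] y by auto
  qed
  with crown_arc_even[OF hop_arc[OF y]] less.prems m n y show ?case by auto
qed

text \<open>Strictly between \<open>1\<close> and \<open>2n - 1\<close> an odd vertex has neither a
  chord nor an exit, and \<open>2j + 1\<close>, entered from \<open>2j\<close>, cannot turn
  back.\<close>

lemma odd_up: "m \<le> j \<Longrightarrow> Suc j < n \<Longrightarrow> hop (2*j + 1) (2*j + 2)"
proof -
  assume j: "m \<le> j" "Suc j < n"
  then obtain y where y: "hop (2*j + 1) y"
    using ex_hop_from[of "2*j + 1"] m n N by (auto simp: crown_exit_def)
  have "y \<noteq> 2*j" using hop_asym[OF y] even_up[of j] j by auto
  with hop_arc[OF y] j m n y show ?thesis by (auto simp: crown_arc_def)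
qed

lemma odd_down: "1 \<le> j \<Longrightarrow> Suc j < m \<Longrightarrow> hop (2*j + 1) (2*j)"
proof -
  assume j: "1 \<le> j" "Suc j < m"
  then obtain y where y: "hop (2*j + 1) y"
    using ex_hop_from[of "2*j + 1"] m n N by (auto simp: crown_exit_def)
  have "y \<noteq> 2*j + 2" using hop_asym[OF y] even_down[of "Suc j"] j by auto
  with hop_arc[OF y] j m n y show ?thesis by (auto simp: crown_arc_def)
qed

lemma bottom_up:
  assumes "2*m \<le> x" "x < 2*n - 1"
  shows "hop x (Suc x)"
proof (cases "even x")
  case True
  then obtain j where "x = 2*j" by (rule evenE)
  then show ?thesis using even_up[of j] assms by simp
next
  case False
  then obtain j where "x = 2*j + 1" by (rule oddE)
  then show ?thesis using odd_up[of j] assms by simp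
qed

lemma bottom_down:
  assumes "1 \<le> x" "Suc x < 2*m - 1"
  shows "hop (Suc x) x"
proof (cases "even x")
  case True
  then obtain j where "x = 2*j" by (rule evenE)
  then show ?thesis using odd_down[of j] assms by simp
next
  case False
  then obtain j where "x = 2*j + 1" by (rule oddE)
  then show ?thesis using even_down[of "Suc j"] assms by simp
qed

section \<open>Forced direction along the top\<close>

lemma top_pred:
  assumes "hop y x" "2*n \<le> x"
  shows "y = Suc x \<or> x = Suc y \<or> (x = N \<and> y = 1)"
  using hop_arc[OF assms(1)] assms(2) n N by (auto simp: crown_arc_def)

text \<open>If \<open>x\<close> does not step up, its upper neighbour is entered from above. No ring
  edge is used in both directions, so this propagates upwards to \<open>N\<close>, whose only
  remaining predecessor is \<open>1\<close>.\<close>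

lemma top_down:
  assumes x: "2*n \<le> x" "x < N" and nR: "\<not> hop x (Suc x)"
  shows "x < y \<Longrightarrow> y \<le> N \<Longrightarrow> if y = N then hop 1 N else hop (Suc y) y"
proof (induction y)
  case (Suc y)
  obtain z where z: "hop z (Suc y)" using ex_hop_to[of "Suc y"] Suc.prems m n x by auto
  have "z \<noteq> y"
    using Suc hop_asym[of "Suc y" y] nR z by (cases "y = x") auto
  with top_pred[OF z] Suc.prems x z show ?case by (auto simp: hop_def)
qed simp

text \<open>The same propagation downwards, ending with the step from \<open>2n - 1\<close> to
  \<open>2n\<close>.\<close>

lemma top_up:
  assumes x: "2*n < x" "x \<le> N" and nR: "\<not> hop x (x - 1)"
  shows "2*n \<le> y \<Longrightarrow> y < x \<Longrightarrow> hop (y - 1) y"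
proof (induction "x - y" arbitrary: y rule: less_induct)
  case less
  obtain z where z: "hop z y" using ex_hop_to[of y] less.prems m n x by auto
  have "z \<noteq> Suc y"
  proof (cases "Suc y = x")
    case False
    with less.prems have "hop y (Suc y)" using less.hyps[of "Suc y"] by auto
    then show ?thesis using hop_asym z by blast
  qed (use nR z in auto)
  with top_pred[OF z] less.prems x z show ?case by (auto simp: hop_def)
qed

section \<open>Positions of all vertices when \<open>b + 3 \<le> m\<close>\<close>

lemma pos_down_run:
  assumes "\<And>y. x \<le> y \<Longrightarrow> y < z \<Longrightarrow> hop (Suc y) y" "x \<le> z"
  shows "pos x = pos z + (z - x)"
  using assms(2,1)
proof (induction z rule: dec_induct)
  case (step z)
  then show ?case using hop_pos[of "Suc z" z] by auto
qed simp

lemma pos_up_run: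
  assumes "\<And>y. x \<le> y \<Longrightarrow> y < z \<Longrightarrow> hop y (Suc y)" "x \<le> z"
  shows "pos z = pos x + (z - x)"
  using assms(2,1)
proof (induction z rule: dec_induct)
  case (step z)
  then show ?case using hop_pos[of z "Suc z"] by auto
qed simp


text \<open>Otherwise \<open>2m - 2\<close> is entered by a chord from some \<open>t\<close>, and \<open>t + 1\<close> has neither a chord nor an
  outgoing edge, so it steps to \<open>t\<close> and closes the cycle \<open>2m - 2, \<dots>, 1, N, \<dots>, t\<close>.\<close>

lemma start_down:
  assumes m': "b + 3 \<le> m"
  shows "hop (2*m - 1) (2*m - 2)"
proof (rule ccontr)
  assume nR: "\<not> hop (2*m - 1) (2*m - 2)"
  have "1 \<le> 2*m - 2" "2*m - 2 \<le> N" "Suc (2*m - 2) \<noteq> 2*m" using m m' n N by linarith+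
  then obtain t where t: "hop t (2*m - 2)" using ex_hop_to[of "2*m - 2"] by blast
  have "t \<noteq> 2*m - 3" using hop_asym[OF t] even_down[of "m - 1"] m' by (auto simp: diff_mult_distrib2)
  moreover have "t \<noteq> 2*m - 1" using nR t by auto
  moreover have "2*m - 2 \<noteq> N" using m n N by linarith
  moreover have "2*m - 2 \<noteq> 1" by presburger
  moreover have "2*m - 2 \<noteq> 2*i + 2" if "i \<le> b" for i using that m' by linarith
  moreover have "t = 2*m - 3" if "2*m - 2 = Suc t" using that by linarith
  moreover have "t = 2*m - 1" if "t = Suc (2*m - 2)" using that m' by linarith
  ultimately obtain i where i: "i \<le> a" "t = 2*a + 2*b + 8 + 3*i"
    using hop_arc[OF t] unfolding crown_arc_def N by blast
  have tN: "Suc t < N" "2*n \<le> t" using i n N by linarith+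
  have ntR: "\<not> hop t (Suc t)" using hop_right_unique[OF t, of "Suc t"] m tN by auto
  have down: "if y = N then hop 1 N else hop (Suc y) y" if "t < y" "y \<le> N" for y
    using top_down[of t y] tN ntR that by auto
  \<comment> \<open>Modulo 3 and relative to \<open>2a + 2b\<close>, the chord tails and the exits
    in the top lie in the classes 1 and 2, whereas \<open>Suc t\<close> lies in the class 0.\<close>
  have no_chord: "Suc t + 3*k \<noteq> 5*a + 5*b + 10" for k unfolding i(2) by presburger
  have "Suc t \<noteq> 2*a + 2*b + 7 + 3*k" "Suc t + 3*k \<noteq> 5*a + 5*b + 11" for k
    unfolding i(2) by presburger+
  then have "\<not> crown_exit a b (Suc t)"
    using no_chord[of 0] i(2) unfolding crown_exit_def by simp
  then obtain z where z: "hop (Suc t) z" using ex_hop_from[of "Suc t"] tN by auto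
  have mid: "Suc t \<noteq> 2*a + 2*b + 8 + 3*k" for k unfolding i(2) by presburger
  have "z \<noteq> Suc (Suc t)"
    using down[of "Suc t"] hop_asym[OF z] tN by auto
  then have "z = t"
    using hop_arc[OF z] no_chord no_chord[of 0] mid i(2) unfolding crown_arc_def by simp
  then have run: "hop (Suc y) y" if "t \<le> y" "y < N" for y
    using down[of y] z that by (cases "y = t") auto
  have "pos t = pos N + (N - t)" by (rule pos_down_run) (use run tN in auto)
  moreover have "pos N = Suc (pos 1)" using down[of N] tN hop_pos by auto
  moreover have "pos 1 = pos (2*m - 2) + (2*m - 2 - 1)"
    by (rule pos_down_run) (use bottom_down m' in auto)
  moreover have "pos (2*m - 2) = Suc (pos t)" using t hop_pos by auto
  ultimately show False by auto
qed

text \<open>With \<open>t = chord_tail n m\<close>, the branches are the consecutive segments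
  \<open>2m - 1, ..., 1\<close>, then \<open>N, ..., t\<close>, then \<open>2m, ..., t - 1\<close>.
  The last one is empty for \<open>m = n\<close>, where \<open>t = 2n\<close>. Such a closed formula
  yields both the uniqueness of the traversal and its final vertex.\<close>

lemma pos_left:
  assumes m': "b + 3 \<le> m" and x: "x \<in> {1..N}"
  shows "pos x = (if x < 2*m then 2*m - 1 - x
                  else if chord_tail n m \<le> x then 2*m - 1 + (N - x) else N + x - chord_tail n m)"
proof -
  define t where "t = chord_tail n m"
  have tN: "t < N" "2*n \<le> t" unfolding t_def chord_tail_def using m m' n N by auto
  have bottom: "pos x = 2*m - 1 - x" if "1 \<le> x" "x < 2*m" for x
  proof -
    have "pos x = pos (2*m - 1) + (2*m - 1 - x)"
    proof (rule pos_down_run)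
      fix y assume y: "x \<le> y" "y < 2*m - 1"
      show "hop (Suc y) y"
      proof (cases "Suc y = 2*m - 1")
        case True
        then have "y = 2*m - 2" by simp
        then show ?thesis using start_down[OF m'] True by simp
      next
        case False
        then show ?thesis using bottom_down[of y] y that by simp
      qed
    qed (use that in auto)
    then show ?thesis using start by simp
  qed
  \<comment> \<open>The direction of the top is decided at \<open>t\<close>. For
    \<open>m = n\<close> the vertex \<open>2n\<close> cannot be entered from the start, which has
    stepped down. For \<open>m < n\<close> both ring neighbours of \<open>2m\<close> are excluded as
    predecessors, so \<open>t\<close> spends its step on the chord and moves to neither ring
    neighbour.\<close>
  have main: "hop (Suc t) t \<and> \<not> hop t (Suc t) \<and>
    (m < n \<longrightarrow> hop t (2*m) \<and> (\<forall>y. 2*n \<le> y \<longrightarrow> y < t \<longrightarrow> hop (y - 1) y))"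
  proof (cases "m = n")
    case True
    then have t: "t = 2*n" by (simp add: t_def chord_tail_def)
    obtain z where z: "hop z (2*n)" using ex_hop_to[of "2*n"] m n N by auto
    have "z \<noteq> 2*n - 1"
      using hop_right_unique[of "2*n - 1" "2*n" "2*n - 2"] start_down[OF m'] z True n by auto
    then have "z = Suc t" using top_pred[OF z] t n N by auto
    then show ?thesis using z t True hop_asym[OF z] by auto
  next
    case False
    then have mn: "m < n" using m by simp
    obtain z where z: "hop z (2*m)" using ex_hop_to[of "2*m"] m mn n N by auto
    have "z \<noteq> 2*m - 1"
      using hop_right_unique[of "2*m - 1" "2*m" "2*m - 2"] start_down[OF m'] z m' by auto
    moreover have "z \<noteq> Suc (2*m)" using hop_asym[OF z] bottom_up[of "2*m"] mn by auto
    moreover have "2*m \<noteq> N" using m n N by linarith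
    moreover have "2*m \<noteq> 1" by presburger
    moreover have "2*m \<noteq> 2*i + 2" if "i \<le> b" for i using that m' by linarith
    moreover have "z = 2*m - 1" if "2*m = Suc z" using that by linarith
    ultimately obtain i where i: "z = 2*a + 2*b + 8 + 3*i" "2*m + 2*i = 2*a + 2*b + 6"
      using hop_arc[OF z] unfolding crown_arc_def N by blast
    then have zt: "z = t" using mn n unfolding t_def chord_tail_def by simp
    note tm = z[unfolded zt]
    have nR: "\<not> hop t (Suc t)" "\<not> hop t (t - 1)"
      using hop_right_unique[OF tm, of "Suc t"] hop_right_unique[OF tm, of "t - 1"] tN mn by linarith+
    have up: "hop (y - 1) y" if "2*n \<le> y" "y < t" for y
      using top_up[of t y] that nR tN by auto
    obtain w where w: "hop w t" using ex_hop_to[of t] tN mn n by auto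
    \<comment> \<open>Entering \<open>t\<close> from below would close the cycle
      \<open>2m, ..., t\<close> through the chord back to \<open>2m\<close>.\<close>
    have "w \<noteq> t - 1"
    proof
      assume "w = t - 1"
      then have run: "hop y (Suc y)" if "2*m \<le> y" "y < t" for y
        using bottom_up[of y] up[of "Suc y"] w that by (cases "Suc y = t"; cases "y < 2*n - 1") auto
      have "pos t = pos (2*m) + (t - 2*m)"
        by (rule pos_up_run) (use run tN mn in auto)
      then show False using hop_pos[OF tm] by simp
    qed
    then have "hop (Suc t) t" using top_pred[OF w] w tN by auto
    then show ?thesis using nR tm up by auto
  qed
  have down: "if y = N then hop 1 N else hop (Suc y) y" if "t \<le> y" "y \<le> N" for y
    using top_down[of t y] tN main that by (cases "y = t") auto
  have top: "pos x = 2*m - 1 + (N - x)" if "t \<le> x" "x \<le> N" for x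
  proof -
    have "pos x = pos N + (N - x)"
      by (rule pos_down_run) (use down that in force)+
    moreover have "pos N = Suc (pos 1)" using down[of N] tN hop_pos by auto
    moreover have "pos 1 = 2*m - 2" using bottom[of 1] m by simp
    ultimately show ?thesis using m by simp
  qed
  have middle: "pos x = N + x - t" if "2*m \<le> x" "x < t" for x
  proof -
    have mn: "m < n" using that by (auto simp: t_def chord_tail_def split: if_splits)
    have "pos x = pos (2*m) + (x - 2*m)"
    proof (rule pos_up_run)
      fix y assume y: "2*m \<le> y" "y < x"
      have "hop y (Suc y)" if "2*n \<le> Suc y" using main mn that y \<open>x < t\<close> by force
      then show "hop y (Suc y)" using bottom_up[of y] y by (cases "y < 2*n - 1") auto
    qed (use that in auto)
    moreover have "pos (2*m) = Suc (pos t)" using main mn hop_pos by auto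
    moreover have "pos t = 2*m - 1 + (N - t)" using top[of t] tN by simp
    ultimately show ?thesis using tN that m by linarith
  qed
  show ?thesis using bottom top middle x unfolding t_def by auto
qed

end

section \<open>Reflecting the crown\<close>

text \<open>A reflection of the ring \<open>1, ..., N\<close>, reversing the bottom
  \<open>1, ..., 2n - 1\<close> and the top \<open>2n, ..., N\<close> separately. It sends
  \<open>2m - 1\<close> to \<open>2(n + 1 - m) - 1\<close> and exchanges the two chord families,
  hence \<open>a\<close> and \<open>b\<close>.\<close>

definition mirror :: "nat \<Rightarrow> nat \<Rightarrow> nat \<Rightarrow> nat" where
  "mirror n N x = (if x < 2*n then 2*n - x else N + 2*n - x)"

lemma crown_arc_mirror:
  assumes n: "n = a + b + 4" and N: "N = 5*a + 5*b + 10"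
    and xy: "x \<in> {1..N}" "y \<in> {1..N}" and arc: "crown_arc a b x y"
  shows "crown_arc b a (mirror n N x) (mirror n N y)"
proof -
  let ?x = "mirror n N x" and ?y = "mirror n N y"
  have Nn: "2*n < N" using n N by simp
  consider "y = Suc x" | "x = Suc y" | "x = 1" "y = N" | "x = N" "y = 1"
    | i where "i \<le> a" "x = 2*a + 2*b + 8 + 3*i" "y + 2*i = 2*a + 2*b + 6"
    | i where "i \<le> b" "x + 3*i = 5*a + 5*b + 10" "y = 2*i + 2"
    using arc unfolding crown_arc_def N by blast
  then consider "?y = Suc ?x \<or> ?x = Suc ?y \<or> ?x = 1 \<and> ?y = N \<or> ?x = N \<and> ?y = 1"
    | i where "i \<le> a" "?x + 3*i = 5*b + 5*a + 10" "?y = 2*i + 2"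
    | i where "i \<le> b" "?x = 2*b + 2*a + 8 + 3*i" "?y + 2*i = 2*b + 2*a + 6"
  proof cases
    case 1
    \<comment> \<open>The ring edge between \<open>2n - 1\<close> and \<open>2n\<close> is the one
      whose image joins \<open>1\<close> and \<open>N\<close>, hence its own case.\<close>
    consider "Suc x < 2*n" | "Suc x = 2*n" | "2*n \<le> x" by linarith
    then show ?thesis using 1 xy Nn by (cases; intro that(1)) (simp_all add: mirror_def, linarith+)
  next
    case 2
    consider "Suc y < 2*n" | "Suc y = 2*n" | "2*n \<le> y" by linarith
    then show ?thesis using 2 xy Nn by (cases; intro that(1)) (simp_all add: mirror_def, linarith+)
  next
    case 3
    with n N have "?y = Suc ?x" by (simp add: mirror_def)
    then show ?thesis by (blast intro: that(1))
  next
    case 4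
    with n N have "?x = Suc ?y" by (simp add: mirror_def)
    then show ?thesis by (blast intro: that(1))
  next
    case (5 i)
    then show ?thesis using n N by (intro that(2)[of i]) (auto simp: mirror_def)
  next
    case (6 i)
    then show ?thesis using n N by (intro that(3)[of i]) (auto simp: mirror_def)
  qed
  then show ?thesis
  proof cases
    case 1
    moreover have "N = 5*b + 5*a + 10" using N by simp
    ultimately show ?thesis unfolding crown_arc_def by blast
  qed (unfold crown_arc_def, blast+)
qed

lemma crown_exit_mirror:
  assumes n: "n = a + b + 4" and N: "N = 5*a + 5*b + 10"
    and x: "x \<in> {1..N}" and exit: "crown_exit a b x"
  shows "crown_exit b a (mirror n N x)"
proof -
  consider "x = 1" | "x = 2*n" | "x = N"
    | i where "i \<le> a" "x = 2*a + 2*b + 7 + 3*i"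
    | i where "i \<le> b" "x + 3*i = 5*a + 5*b + 11"
    using exit unfolding crown_exit_def n N by fastforce
  then show ?thesis
  proof cases
    case 1
    then have "mirror n N x = 2*b + 2*a + 7 + 3*0" using n by (simp add: mirror_def)
    then show ?thesis unfolding crown_exit_def by blast
  next
    case 2
    then show ?thesis using N by (simp add: mirror_def crown_exit_def)
  next
    case 3
    then show ?thesis using n N by (simp add: mirror_def crown_exit_def)
  next
    case (4 i)
    \<comment> \<open>The instance \<open>i = 0\<close> is the exit \<open>2n - 1\<close>, which
      reflects to the exit \<open>1\<close>.\<close>
    then have "mirror n N x = 1 \<or> mirror n N x + 3*i = 5*b + 5*a + 11"
      using n N by (cases "i = 0") (auto simp: mirror_def)
    with 4 show ?thesis unfolding crown_exit_def by blast
  next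
    case (5 i)
    then have "mirror n N x = 2*b + 2*a + 7 + 3*i"
      using n N x by (auto simp: mirror_def)
    with 5 show ?thesis unfolding crown_exit_def by blast
  qed
qed

lemma mirror_in: "n = a + b + 4 \<Longrightarrow> N = 5*a + 5*b + 10 \<Longrightarrow> x \<in> {1..N} \<Longrightarrow> mirror n N x \<in> {1..N}"
  by (auto simp: mirror_def)

lemma mirror_mirror: "n = a + b + 4 \<Longrightarrow> N = 5*a + 5*b + 10 \<Longrightarrow> x \<in> {1..N} \<Longrightarrow> mirror n N (mirror n N x) = x"
  by (auto simp: mirror_def)

section \<open>The last vertex of a traversal and the matching of labels\<close>

text \<open>Tail of the outgoing edge labelled \<open>m\<close>.\<close>

definition crown_tail :: "nat \<Rightarrow> nat \<Rightarrow> nat \<Rightarrow> nat" where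
  "crown_tail a b m =
     (if m = 1 then 5*a + 5*b + 10 else if m = 2 then 1
      else if m = a + b + 4 then 2*a + 2*b + 8
      else if m \<le> b + 2 then 5*a + 5*b + 17 - 3*m else 5*a + 5*b + 16 - 3*m)"

lemma crown_tail_bounds:
  assumes "1 \<le> i" "i \<le> a + b + 4"
  shows "crown_tail a b i \<in> {1..5*a + 5*b + 10}"
  using assms unfolding crown_tail_def by auto

context crown_traversal
begin

lemma mirrored: "crown_traversal b a n N (n + 1 - m) (pos \<circ> mirror n N)"
proof
  have "bij_betw (mirror n N) {1..N} {1..N}"
    by (rule bij_betwI[where g = "mirror n N"])
       (use mirror_in[OF n N] mirror_mirror[OF n N] in auto)
  then show "bij_betw (pos \<circ> mirror n N) {1..N} {..<N}"
    using bij by (rule bij_betw_trans)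
  have "mirror n N (2*(n + 1 - m) - 1) = 2*m - 1" using m n N by (auto simp: mirror_def)
  then show "(pos \<circ> mirror n N) (2*(n + 1 - m) - 1) = 0" using start by simp
next
  fix x y
  assume xy: "x \<in> {1..N}" "y \<in> {1..N}" "(pos \<circ> mirror n N) y = Suc ((pos \<circ> mirror n N) x)"
  then have "crown_arc a b (mirror n N x) (mirror n N y)"
    using steps mirror_in[OF n N] by simp
  from crown_arc_mirror[OF n N _ _ this] show "crown_arc b a x y"
    using mirror_in[OF n N] mirror_mirror[OF n N] xy by simp
next
  fix x
  assume x: "x \<in> {1..N}" "Suc ((pos \<circ> mirror n N) x) = N"
  then have "crown_exit a b (mirror n N x)"
    using final mirror_in[OF n N] by simp
  from crown_exit_mirror[OF n N _ this] show "crown_exit b a x"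
    using mirror_in[OF n N] mirror_mirror[OF n N] x by simp
qed (use m n N in auto)

text \<open>For the reflected traversal the hypothesis of \<open>pos_left\<close> reads
  \<open>a + 3 \<le> n + 1 - m\<close>, that is \<open>m \<le> b + 2\<close>. The two formulas
  therefore cover every \<open>m\<close>.\<close>

lemma pos_right:
  assumes m': "m \<le> b + 2" and x: "x \<in> {1..N}"
  shows "pos x = (let y = mirror n N x; k = n + 1 - m; t = chord_tail n k in
                  if y < 2*k then 2*k - 1 - y
                  else if t \<le> y then 2*k - 1 + (N - y) else N + y - t)"
  using crown_traversal.pos_left[OF mirrored _ mirror_in[OF n N x]] m' n mirror_mirror[OF n N x]
  by (simp add: Let_def)

lemma crown_tail_in: "crown_tail a b m \<in> {1..N}"
  using crown_tail_bounds m n N by simp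

lemma pos_tail_left:
  assumes "b + 3 \<le> m"
  shows "pos (if m = n then 2*n else chord_tail n m - 1) = N - 1"
proof (cases "m = n")
  case True
  then show ?thesis using pos_left[OF assms, of "2*n"] n N by (simp add: chord_tail_def)
next
  case False
  define t where "t = chord_tail n m"
  have "2*n \<le> t" "t < N" "m < n" unfolding t_def chord_tail_def using m assms False n N by auto
  then have "1 \<le> t - 1" "t - 1 \<le> N" "\<not> t - 1 < 2*m" "\<not> t \<le> t - 1" "N + (t - 1) - t = N - 1"
    by linarith+
  then show ?thesis
    using pos_left[OF assms, of "t - 1"] False unfolding t_def[symmetric] by simp
qed

text \<open>The final vertex, read off from \<open>pos_left\<close> directly or through the
  reflection, is the tail carrying the label of the entry. This is the source of the equality of the
  two labels.\<close>

lemma pos_tail: "pos (crown_tail a b m) = N - 1"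
proof (cases "b + 3 \<le> m")
  case True
  then have "crown_tail a b m = (if m = n then 2*n else chord_tail n m - 1)"
    unfolding crown_tail_def chord_tail_def n using m n by auto
  then show ?thesis using pos_tail_left[OF True] by simp
next
  case False
  let ?k = "n + 1 - m"
  have "mirror n N (if ?k = n then 2*n else chord_tail n ?k - 1) = crown_tail a b m"
  proof -
    \<comment> \<open>For \<open>m = 1\<close> the reflected walk ends at \<open>2n\<close>, whose
      image is \<open>N\<close>; for \<open>m = 2\<close> it ends at \<open>2n - 1\<close>, which
      belongs to the bottom and has image \<open>1\<close>.\<close>
    consider "m = 1" | "m = 2" | "3 \<le> m" using m by linarith
    then show ?thesis
      using m n N False by cases (auto simp: mirror_def crown_tail_def chord_tail_def)
  qed
  then show ?thesis
    using crown_traversal.pos_tail_left[OF mirrored] False n by simp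
qed

lemma last_is_tail: "x \<in> {1..N} \<Longrightarrow> Suc (pos x) = N \<Longrightarrow> x = crown_tail a b m"
  using pos_inj[OF _ crown_tail_in] pos_tail by simp

end

lemma crown_traversal_unique:
  assumes "crown_traversal a b n N m pos" "crown_traversal a b n N m pos'" "x \<in> {1..N}"
  shows "pos x = pos' x"
proof (cases "b + 3 \<le> m")
  case True
  then show ?thesis
    using crown_traversal.pos_left[OF assms(1) True assms(3)]
      crown_traversal.pos_left[OF assms(2) True assms(3)] by simp
next
  case False
  then have "m \<le> b + 2" by simp
  then show ?thesis
    using crown_traversal.pos_right[OF assms(1) _ assms(3)]
      crown_traversal.pos_right[OF assms(2) _ assms(3)] by simp
qed

text \<open>Label 1 has the largest tail, label 2 the smallest, and the tails decrease from label 3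
  to label \<open>n - 1\<close>. The tail \<open>2n\<close> of label \<open>n\<close> falls outside
  this order, but differs modulo 3 from the tails \<open>5a + 5b + 16 - 3i\<close>.\<close>

lemma crown_tail_neq:
  assumes "1 \<le> i" "i < j" "j \<le> a + b + 4"
  shows "crown_tail a b i \<noteq> crown_tail a b j"
proof -
  consider "i = 1" | "i = 2" | "3 \<le> i" "j = a + b + 4" "b + 2 < i"
    | "3 \<le> i" "j = a + b + 4" "i \<le> b + 2" | "3 \<le> i" "j < a + b + 4"
    using assms by linarith
  then show ?thesis
  proof cases
    case 1
    then have "crown_tail a b j < crown_tail a b i"
      using assms unfolding crown_tail_def by auto
    then show ?thesis by simp
  next
    case 2
    then have "crown_tail a b i < crown_tail a b j"
      using assms unfolding crown_tail_def by auto
    then show ?thesis by simp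
  next
    case 3
    then have eq: "crown_tail a b i = 5*a + 5*b + 16 - 3*i" "crown_tail a b j = 2*a + 2*b + 8"
      using assms unfolding crown_tail_def by simp_all
    show ?thesis
    proof
      assume "crown_tail a b i = crown_tail a b j"
      then have "3*i = 3*a + 3*b + 8" unfolding eq by linarith
      then show False by presburger
    qed
  next
    case 4
    then have "crown_tail a b j < crown_tail a b i"
      using assms unfolding crown_tail_def by auto
    then show ?thesis by simp
  next
    case 5
    then have "crown_tail a b j < crown_tail a b i"
      using assms unfolding crown_tail_def by auto
    then show ?thesis by simp
  qed
qed

lemma crown_tail_inj: "inj_on (crown_tail a b) {1..a + b + 4}"
  by (rule linorder_inj_onI) (auto simp: crown_tail_neq)

lemma crown_exit_tail:
  assumes "1 \<le> i" "i \<le> a + b + 4"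
  shows "crown_exit a b (crown_tail a b i)"
proof -
  consider "i = 1" | "i = 2" | "i = a + b + 4" | "3 \<le> i" "i \<le> b + 2" | "b + 3 \<le> i" "3 \<le> i" "i < a + b + 4"
    using assms by linarith
  then show ?thesis
  proof cases
    case 4
    then have "crown_tail a b i + 3*(i - 2) = 5*a + 5*b + 11" "i - 2 \<le> b"
      unfolding crown_tail_def by auto
    then show ?thesis unfolding crown_exit_def by blast
  next
    case 5
    then have "crown_tail a b i = 2*a + 2*b + 7 + 3*(a + b + 3 - i)" "a + b + 3 - i \<le> a"
      unfolding crown_tail_def by auto
    then show ?thesis unfolding crown_exit_def by blast
  qed (auto simp: crown_tail_def crown_exit_def)
qed

section \<open>Traversals given as lists of vertices\<close>

text \<open>Indexing a repetition-free list of all \<open>N\<close> vertices is a bijection, and its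
  inverse is the position function that the preceding analysis needs.\<close>

lemma crown_traversal_of_list:
  assumes n: "n = a + b + 4" and N: "N = 5*a + 5*b + 10" and m: "1 \<le> m" "m \<le> n"
    and w: "distinct w" "set w = {1..N}" "hd w = 2*m - 1"
      "successively (crown_arc a b) w" "crown_exit a b (last w)"
  shows "crown_traversal a b n N m (the_inv_into {..<N} ((!) w))"
proof -
  define pos where "pos = the_inv_into {..<N} ((!) w)"
  have len: "length w = N" using distinct_card[OF w(1)] w(2) by simp
  have bij: "bij_betw ((!) w) {..<N} {1..N}"
    using bij_betw_nth[OF w(1)] len w(2) by simp
  have pos_nth: "pos (w ! k) = k" if "k < N" for k
    unfolding pos_def using that bij by (intro the_inv_into_f_f) (auto simp: bij_betw_def)
  have nth_pos: "w ! pos x = x" "pos x < N" if x: "x \<in> {1..N}" for x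
  proof -
    obtain k where "k < N" "x = w ! k" using bij_betw_imp_surj_on[OF bij] x by blast
    then show "w ! pos x = x" "pos x < N" using pos_nth by simp_all
  qed
  have "w \<noteq> []" using len N by auto
  show ?thesis unfolding pos_def[symmetric]
  proof
    show "bij_betw pos {1..N} {..<N}"
      unfolding pos_def using bij by (rule bij_betw_the_inv_into)
    show "pos (2*m - 1) = 0"
      using pos_nth[of 0] w(3) hd_conv_nth[OF \<open>w \<noteq> []\<close>] N by simp
  next
    fix x y assume xy: "x \<in> {1..N}" "y \<in> {1..N}" "pos y = Suc (pos x)"
    then have "crown_arc a b (w ! pos x) (w ! Suc (pos x))"
      using w(4) nth_pos(2)[OF xy(2)] len by (simp add: successively_conv_nth)
    then show "crown_arc a b x y" using nth_pos(1) xy by metis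
  next
    fix x assume x: "x \<in> {1..N}" "Suc (pos x) = N"
    then have "last w = w ! pos x"
      using last_conv_nth[OF \<open>w \<noteq> []\<close>] len by (metis diff_Suc_1)
    then show "crown_exit a b x" using nth_pos(1)[OF x(1)] w(5) by simp
  qed (use n N m in auto)
qed

lemma crown_list_unique:
  assumes n: "n = a + b + 4" and N: "N = 5*a + 5*b + 10" and m: "1 \<le> m" "m \<le> n"
    and w: "distinct w" "set w = {1..N}" "hd w = 2*m - 1"
      "successively (crown_arc a b) w" "crown_exit a b (last w)"
    and w': "distinct w'" "set w' = {1..N}" "hd w' = 2*m - 1"
      "successively (crown_arc a b) w'" "crown_exit a b (last w')"
  shows "w = w'" "last w = crown_tail a b m"
proof -
  note tr = crown_traversal_of_list[OF n N m]
  have len: "length w = N" "length w' = N"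
    using distinct_card[OF w(1)] w(2) distinct_card[OF w'(1)] w'(2) by simp_all
  have inj: "inj_on ((!) w) {..<N}" "inj_on ((!) w') {..<N}"
    using inj_on_nth[OF w(1), of "{..<N}"] inj_on_nth[OF w'(1), of "{..<N}"] len by auto
  have img: "(!) w ` {..<N} = {1..N}" "(!) w' ` {..<N} = {1..N}"
    using bij_betw_nth[OF w(1)] bij_betw_nth[OF w'(1)] len w(2) w'(2)
    by (auto simp: bij_betw_def)
  have "w \<noteq> []" using len(1) N by auto
  show "w = w'"
  proof (rule nth_equalityI)
    fix k assume "k < length w"
    then have k: "k < N" using len by simp
    then have x: "w ! k \<in> {1..N}" using img by blast
    have "the_inv_into {..<N} ((!) w') (w ! k) = the_inv_into {..<N} ((!) w) (w ! k)"
      by (rule crown_traversal_unique[OF tr[OF w'] tr[OF w] x])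
    also have "\<dots> = k" using inj(1) k by (intro the_inv_into_f_f) auto
    finally show "w ! k = w' ! k"
      using f_the_inv_into_f[OF inj(2), of "w ! k"] x img by simp
  qed (use len in simp)
  then have last: "last w = w ! (N - 1)" using last_conv_nth[OF \<open>w \<noteq> []\<close>] len(1) by simp
  have "the_inv_into {..<N} ((!) w) (last w) = N - 1"
    unfolding last by (rule the_inv_into_f_f[OF inj(1)]) (use N in simp)
  then have "Suc (the_inv_into {..<N} ((!) w) (last w)) = N" using N by linarith
  moreover have "last w \<in> {1..N}" using last_in_set[OF \<open>w \<noteq> []\<close>] unfolding w(2) .
  ultimately show "last w = crown_tail a b m"
    using crown_traversal.last_is_tail[OF tr[OF w]] by blast
qed

section \<open>Passing through a crown inside a larger graph\<close>

text \<open>A closed walk without a distinguished start vertex; unlike \<open>pcas\<close>, it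
  survives rotation of the arc list.\<close>

definition cyclic_chain :: "('a \<times> 'a) list \<Rightarrow> bool" where
  "cyclic_chain p \<longleftrightarrow> p \<noteq> [] \<and> successively (\<lambda>e f. snd e = fst f) p \<and> snd (last p) = fst (hd p)"

lemma pcas_iff_successively:
  "pcas u (e # p) w \<longleftrightarrow>
    fst e = u \<and> successively (\<lambda>e f. snd e = fst f) (e # p) \<and> snd (last (e # p)) = w"
proof (induction p arbitrary: u e)
  case (Cons f p)
  have "pcas u (e # f # p) w \<longleftrightarrow> fst e = u \<and> pcas (snd e) (f # p) w" by simp
  also have "\<dots> \<longleftrightarrow> fst e = u \<and> fst f = snd e \<and>
      successively (\<lambda>e f. snd e = fst f) (f # p) \<and> snd (last (f # p)) = w"
    unfolding Cons.IH ..
  finally have step: "pcas u (e # f # p) w \<longleftrightarrow> fst e = u \<and> fst f = snd e \<and>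
      successively (\<lambda>e f. snd e = fst f) (f # p) \<and> snd (last (f # p)) = w" .
  have "last (e # f # p) = last (f # p)" by simp
  then show ?case unfolding step successively.simps(3) by metis
qed simp

lemma pawalk_verts_pcas: "pcas u p w \<Longrightarrow> pawalk_verts u p = u # map snd p"
proof (induction p arbitrary: u)
  case (Cons e p)
  then show ?case using Cons.IH[of "snd e"] by simp
qed simp

lemma cyclic_chain_swap: "cyclic_chain (xs @ ys) \<Longrightarrow> cyclic_chain (ys @ xs)"
  by (cases "xs = []"; cases "ys = []") (auto simp: cyclic_chain_def successively_append_iff)

lemma cyclic_chain_next:
  assumes "cyclic_chain p" "e \<in> set p"
  obtains f where "f \<in> set p" "fst f = snd e"
proof -
  obtain xs ys where p: "p = xs @ e # ys" using assms(2) by (meson split_list)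
  then have "cyclic_chain ((e # ys) @ xs)" using assms(1) cyclic_chain_swap by blast
  then have "\<exists>f\<in>set (e # ys @ xs). fst f = snd e"
    by (cases "ys @ xs") (auto simp: cyclic_chain_def successively_Cons)
  then obtain f where "f \<in> set (e # ys @ xs)" "fst f = snd e" by blast
  then show thesis using that[of f] p by auto
qed

lemma hamiltonian_cycleD:
  assumes "pre_digraph.hamiltonian_cycle (with_proj G) p"
  shows "set p \<subseteq> parcs G" "distinct (map snd p)" "snd ` set p = pverts G" "cyclic_chain p"
proof -
  obtain u where u: "set p \<subseteq> parcs G" "pcas u p u" "distinct (tl (pawalk_verts u p))" "p \<noteq> []"
    and im: "snd ` set p = pverts G"
    using assms unfolding pre_digraph.hamiltonian_cycle_def pre_digraph.cycle_def
      pre_digraph.awalk_def cas_with_proj_eq awalk_verts_with_proj_eq with_proj_simps by blast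
  show "set p \<subseteq> parcs G" "snd ` set p = pverts G" by fact+
  show "distinct (map snd p)" using u(3) pawalk_verts_pcas[OF u(2)] by simp
  show "cyclic_chain p"
  proof (cases p)
    case (Cons e q)
    show ?thesis
      using u(2) unfolding cyclic_chain_def Cons pcas_iff_successively by simp
  qed (use u(4) in simp)
qed

lemma successively_pred:
  assumes "successively (\<lambda>e f. snd e = fst f) (h # q)" "e \<in> set q"
  obtains d where "d \<in> set (h # q)" "snd d = fst e"
proof -
  obtain xs ys where q: "q = xs @ e # ys" using assms(2) by (meson split_list)
  then have "snd (last (h # xs)) = fst e"
    using assms(1) successively_append_iff[of _ "h # xs" "e # ys"] by simp
  then show thesis using that q last_in_set[of "h # xs"]
    by (metis UnI1 append_Cons list.distinct(1) set_append)
qed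

text \<open>Consecutive arcs agree in \<open>G\<close> only at images under \<open>v\<close>;
  injectivity turns this into agreement in the crown. The bounding arcs \<open>h\<close> and
  \<open>g\<close> fix the two ends, also when \<open>q\<close> is empty.\<close>

lemma pcas_pullback:
  assumes "successively (\<lambda>e f. snd e = fst f) (h # map (map_prod v v) q @ [g])"
    and "snd h = v x" "fst g = v t" "inj_on v V" "x \<in> V" "t \<in> V" "set q \<subseteq> V \<times> V"
  shows "pcas x q t"
  using assms
proof (induction q arbitrary: h x)
  case Nil
  then have "v x = v t" by simp
  then show ?case using Nil.prems inj_onD[of v V x t] by simp
next
  case (Cons e q)
  have e: "fst e \<in> V" "snd e \<in> V" using Cons.prems(7) by auto
  have "snd h = v (fst e)" using Cons.prems(1) by simp
  then have "v x = v (fst e)" using Cons.prems(2) by simp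
  then have "x = fst e" using inj_onD[OF Cons.prems(4)] Cons.prems(5) e(1) by blast
  moreover have "pcas (snd e) q t"
    by (rule Cons.IH[of "map_prod v v e"]) (use Cons.prems e in simp_all)
  ultimately show ?case by simp
qed

lemma pcas_successively:
  "pcas x q t \<Longrightarrow> (\<And>y z. (y, z) \<in> set q \<Longrightarrow> P y z) \<Longrightarrow> successively P (x # map snd q)"
proof (induction q arbitrary: x)
  case (Cons e q)
  then show ?case by (cases e) auto
qed simp

lemma pcas_last: "pcas x q t \<Longrightarrow> last (x # map snd q) = t"
  by (induction q arbitrary: x) auto

lemma pcas_unique:
  "pcas x q t \<Longrightarrow> pcas x q' t' \<Longrightarrow> map snd q = map snd q' \<Longrightarrow> q = q'"
proof (induction q arbitrary: x q')
  case (Cons e q)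
  then show ?case by (cases q') (auto simp: prod_eq_iff)
qed simp

section \<open>Hamiltonian cycles of a graph containing the crown\<close>

locale crown_in_graph =
  fixes a b n N :: nat
    and G :: "'a pair_pre_digraph"
    and v :: "nat \<Rightarrow> 'a"
    and inc outg :: "nat \<Rightarrow> 'a \<times> 'a"
  assumes n: "n = a + b + 4" and N: "N = 5*a + 5*b + 10"
    and v: "inj_on v {1..N}"
    and verts: "v ` {1..N} \<subset> pverts G"
    and arc_crown: "parcs (crown n) \<subseteq> {(x, y). x \<in> {1..N} \<and> y \<in> {1..N} \<and> crown_arc a b x y}"
    and inner: "{(x, y) \<in> parcs G. x \<in> v ` {1..N} \<and> y \<in> v ` {1..N}} = map_prod v v ` parcs (crown n)"
    and incoming: "{(x, y) \<in> parcs G. x \<notin> v ` {1..N} \<and> y \<in> v ` {1..N}} = inc ` {1..n}"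
    and inc_heads: "\<And>i. i \<in> {1..n} \<Longrightarrow> snd (inc i) = v (2*i - 1)"
    and outgoing: "{(x, y) \<in> parcs G. x \<in> v ` {1..N} \<and> y \<notin> v ` {1..N}} = outg ` {1..n}"
    and out_tails: "\<And>i. i \<in> {1..n} \<Longrightarrow> fst (outg i) = v (crown_tail a b i)"
begin

abbreviation C :: "'a set" where "C \<equiv> v ` {1..N}"

lemma v_inj: "v x = v y \<Longrightarrow> x \<in> {1..N} \<Longrightarrow> y \<in> {1..N} \<Longrightarrow> x = y"
  by (rule inj_onD[OF v])

lemma inc_outside: "i \<in> {1..n} \<Longrightarrow> fst (inc i) \<notin> C"
proof -
  assume "i \<in> {1..n}"
  then have "inc i \<in> {(x, y) \<in> parcs G. x \<notin> C \<and> y \<in> C}" by (simp only: incoming imageI)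
  then show "fst (inc i) \<notin> C" unfolding mem_Collect_eq case_prod_beta by blast
qed

lemma outg_inside: "i \<in> {1..n} \<Longrightarrow> fst (outg i) \<in> C"
  and outg_outside: "i \<in> {1..n} \<Longrightarrow> snd (outg i) \<notin> C"
proof -
  assume "i \<in> {1..n}"
  then have "outg i \<in> {(x, y) \<in> parcs G. x \<in> C \<and> y \<notin> C}" by (simp only: outgoing imageI)
  then show "fst (outg i) \<in> C" "snd (outg i) \<notin> C" unfolding mem_Collect_eq case_prod_beta by blast+
qed

lemma incD:
  assumes "e \<in> parcs G" "fst e \<notin> C" "snd e \<in> C"
  obtains i where "i \<in> {1..n}" "e = inc i"
proof -
  have "e \<in> {(x, y) \<in> parcs G. x \<notin> C \<and> y \<in> C}" using assms unfolding mem_Collect_eq case_prod_beta by simp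
  then show thesis unfolding incoming using that by (elim imageE)
qed

lemma outgD:
  assumes "e \<in> parcs G" "fst e \<in> C" "snd e \<notin> C"
  obtains i where "i \<in> {1..n}" "e = outg i"
proof -
  have "e \<in> {(x, y) \<in> parcs G. x \<in> C \<and> y \<notin> C}" using assms unfolding mem_Collect_eq case_prod_beta by simp
  then show thesis unfolding outgoing using that by (elim imageE)
qed

lemma innerD:
  assumes "e \<in> parcs G" "fst e \<in> C" "snd e \<in> C"
  obtains d where "d \<in> parcs (crown n)" "e = map_prod v v d"
proof -
  have "e \<in> {(x, y) \<in> parcs G. x \<in> C \<and> y \<in> C}" using assms unfolding mem_Collect_eq case_prod_beta by simp
  then show thesis unfolding inner using that by (elim imageE)
qed

context
  fixes p :: "('a \<times> 'a) list"
  assumes ham: "pre_digraph.hamiltonian_cycle (with_proj G) p"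
begin

lemmas p_arcs = hamiltonian_cycleD(1)[OF ham]
  and p_distinct = hamiltonian_cycleD(2)[OF ham]
  and p_heads = hamiltonian_cycleD(3)[OF ham]
  and p_chain = hamiltonian_cycleD(4)[OF ham]

lemma head_inj: "e \<in> set p \<Longrightarrow> f \<in> set p \<Longrightarrow> snd e = snd f \<Longrightarrow> e = f"
  using p_distinct unfolding distinct_map by (blast dest: inj_onD)

text \<open>Outgoing edges start at exits and no bottom even vertex is an exit, so the cycle
  continues inside the crown, where only the ring neighbours are available.\<close>

lemma even_step:
  assumes "1 \<le> k" "k < n"
  obtains y where "(v (2*k), v y) \<in> set p" "y = Suc (2*k) \<or> 2*k = Suc y" "y \<in> {1..N}"
proof -
  have k: "2*k \<in> {1..N}" "k \<le> a + b + 3" using assms n N by auto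
  then have "v (2*k) \<in> snd ` set p" using verts p_heads by blast
  then obtain f where f: "f \<in> set p" "fst f = v (2*k)"
    using cyclic_chain_next[OF p_chain] by (metis imageE)
  have "snd f \<in> C"
  proof (rule ccontr)
    assume "snd f \<notin> C"
    then obtain i where i: "i \<in> {1..n}" "f = outg i" using outgD f p_arcs k by blast
    then have "v (crown_tail a b i) = v (2*k)" using out_tails f by simp
    moreover have "crown_tail a b i \<in> {1..N}" using crown_tail_bounds i n N by simp
    ultimately have "crown_tail a b i = 2*k" using v_inj k(1) by blast
    then show False
      using crown_exit_tail[of i a b] crown_exit_even[OF assms(1) k(2)] i n by simp
  qed
  moreover have "f \<in> parcs G" "fst f \<in> C" using f p_arcs k by auto
  ultimately obtain d where "d \<in> parcs (crown n)" "f = map_prod v v d"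
    using innerD by blast
  then obtain x y where d: "(x, y) \<in> parcs (crown n)" "f = (v x, v y)"
    by (cases d) simp
  then have xy: "x \<in> {1..N}" "y \<in> {1..N}" "crown_arc a b x y" using arc_crown by auto
  have "v x = v (2*k)" using d f by simp
  then have x: "x = 2*k" using v_inj xy(1) k(1) by blast
  show thesis
    using that[of y] crown_arc_even[OF xy(3)[unfolded x] assms(1) k(2)] xy(2) d(2) f(1)
    unfolding x by blast
qed

text \<open>If \<open>2i - 1\<close> is entered from outside, then \<open>2i, 2i + 2, \<dots>\<close> must all step up, each finding the odd
  vertex below it taken; so no later odd vertex is left to be entered from outside.\<close>

lemma incoming_not_less:
  assumes ij: "i \<in> {1..n}" "j \<in> {1..n}" "inc i \<in> set p" "inc j \<in> set p"
  shows "\<not> i < j"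
proof
  assume less: "i < j"
  have up: "(v (2*k), v (2*k + 1)) \<in> set p" if "i \<le> k" "k < j" for k
    using that
  proof (induction k rule: dec_induct)
    case base
    obtain y where y: "(v (2*i), v y) \<in> set p" "y = Suc (2*i) \<or> 2*i = Suc y"
      using even_step[of i] ij base by auto
    have "y \<noteq> 2*i - 1"
    proof
      assume "y = 2*i - 1"
      then have "(v (2*i), v y) = inc i" using head_inj[OF y(1) ij(3)] inc_heads ij by simp
      then have "v (2*i) \<notin> C" using inc_outside[OF ij(1)] by (metis fst_conv)
      then show False using ij base n N by auto
    qed
    then show ?case using y by auto
  next
    case (step k)
    obtain y where y: "(v (2*Suc k), v y) \<in> set p" "y = Suc (2*Suc k) \<or> 2*Suc k = Suc y"
      using even_step[of "Suc k"] ij step.prems by auto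
    have prev: "(v (2*k), v (2*k + 1)) \<in> set p" using step by simp
    have "y \<noteq> 2*k + 1"
    proof
      assume "y = 2*k + 1"
      then have "v (2*Suc k) = v (2*k)" using head_inj[OF y(1) prev] by simp
      moreover have "2*Suc k \<in> {1..N}" "2*k \<in> {1..N}"
        using ij step.prems step.hyps n N by auto
      ultimately have "2*Suc k = 2*k" by (rule v_inj)
      then show False by simp
    qed
    then show ?case using y by auto
  qed
  obtain l where l: "j = Suc l" using less by (cases j) auto
  have last: "(v (2*l), v (2*l + 1)) \<in> set p" using up[of l] less l by simp
  then have "(v (2*l), v (2*l + 1)) = inc j" using head_inj[OF last ij(4)] inc_heads ij l by simp
  then have "v (2*l) \<notin> C" using inc_outside[OF ij(2)] by (metis fst_conv)
  moreover have "2*l \<in> {1..N}" using ij less n N l by auto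
  ultimately show False by blast
qed

lemma incoming_unique:
  assumes "i \<in> {1..n}" "j \<in> {1..n}" "inc i \<in> set p" "inc j \<in> set p"
  shows "i = j"
  using incoming_not_less[OF assms] incoming_not_less[OF assms(2,1,4,3)] by simp

text \<open>The cycle is cut at its single entry: one block inside the crown, then a remainder that
  avoids it.\<close>

lemma traverse:
  obtains i j k q r where "i \<in> {1..n}" "j \<in> {1..n}"
    "rotate k p = inc i # map (map_prod v v) q @ outg j # r"
    "set q \<subseteq> parcs (crown n)" "\<forall>e\<in>set r. fst e \<notin> C \<and> snd e \<notin> C"
proof -
  let ?S = "successively (\<lambda>e f. snd e = fst f)"
  \<comment> \<open>Starting at a vertex outside the crown, which exists because the inclusion
    \<open>verts\<close> is strict, makes the first arc with head in the crown an incoming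
    edge.\<close>
  obtain u where u: "u \<in> pverts G" "u \<notin> C" using verts by blast
  then obtain e where "e \<in> set p" "snd e = u" using p_heads by (metis imageE)
  then obtain f where f: "f \<in> set p" "fst f = u" using cyclic_chain_next[OF p_chain] by blast
  then obtain xs ys where p: "p = xs @ f # ys" by (meson split_list)
  define p1 where "p1 = f # ys @ xs"
  have p1: "cyclic_chain p1" "set p1 = set p" "rotate (length xs) p = p1"
    using cyclic_chain_swap[of xs "f # ys"] p_chain rotate_append[of xs "f # ys"]
    unfolding p p1_def by auto
  have "v 1 \<in> C" using N by (intro imageI) simp
  then have "v 1 \<in> snd ` set p1" unfolding p1(2) p_heads using verts by blast
  then obtain d where "d \<in> set p1" "v 1 = snd d" by (rule imageE)
  then have "\<exists>e\<in>set p1. snd e \<in> C" using \<open>v 1 \<in> C\<close> by (metis (no_types))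
  then obtain as h bs where p1_eq: "p1 = as @ h # bs" and h: "snd h \<in> C"
    and as: "\<forall>e\<in>set as. snd e \<notin> C"
    using split_list_first_prop[of p1 "\<lambda>e. snd e \<in> C"] by blast
  have h_out: "fst h \<notin> C"
  proof (cases "as = []")
    case True
    then have "h = f" using p1_eq p1_def by simp
    then show ?thesis using f u by simp
  next
    case False
    then have "snd (last as) = fst h"
      using p1(1) unfolding cyclic_chain_def p1_eq successively_append_iff by simp
    then show ?thesis using as False last_in_set by metis
  qed
  define p2 where "p2 = h # bs @ as"
  have p2: "cyclic_chain p2" "set p2 = set p"
    using cyclic_chain_swap[of as "h # bs"] p1 unfolding p1_eq p2_def by auto
  have "rotate (length as) p1 = p2"
    using rotate_append[of as "h # bs"] unfolding p1_eq p2_def by simp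
  then have rot: "rotate (length as + length xs) p = p2"
    unfolding rotate_rotate[symmetric] p1(3) .
  have h_p: "h \<in> set p" using p2(2) unfolding p2_def by auto
  obtain i where i: "i \<in> {1..n}" "h = inc i" using incD[OF _ h_out h] h_p p_arcs by blast
  \<comment> \<open>The rotated cycle returns to the tail of \<open>h\<close>, outside the crown, so
    a first arc \<open>g\<close> with outside head exists; all arcs between \<open>h\<close> and
    \<open>g\<close> have their heads inside.\<close>
  have "snd (last p2) \<notin> C" using p2(1) h_out unfolding cyclic_chain_def p2_def by simp
  then have "\<exists>e\<in>set (bs @ as). snd e \<notin> C"
    using h last_in_set[of "bs @ as"] unfolding p2_def by (cases "bs @ as = []") auto
  then obtain q' g r where eq: "bs @ as = q' @ g # r" and g: "snd g \<notin> C"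
    and q': "\<forall>e\<in>set q'. \<not> snd e \<notin> C"
    using split_list_first_prop[of "bs @ as" "\<lambda>e. snd e \<notin> C"] by blast
  have p2_eq: "p2 = h # q' @ g # r" unfolding p2_def eq ..
  have chain: "?S (h # q' @ g # r)" using p2(1) unfolding cyclic_chain_def p2_eq by simp
  then have chains: "?S (h # q')" "snd (last (h # q')) = fst g" "?S (g # r)"
    using successively_append_iff[of _ "h # q'" "g # r"] by simp_all
  have g_in: "fst g \<in> C"
    using chains(2) h q' last_in_set[of "h # q'"] by (metis list.distinct(1) set_ConsD)
  have "set p2 \<subseteq> parcs G" using p2(2) p_arcs by simp
  then have arcs: "g \<in> parcs G" "set q' \<subseteq> parcs G" "set r \<subseteq> parcs G" unfolding p2_eq by auto
  obtain j where j: "j \<in> {1..n}" "g = outg j" using outgD[OF arcs(1) g_in g] by blast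
  have "\<exists>d. d \<in> parcs (crown n) \<and> e = map_prod v v d" if e: "e \<in> set q'" for e
  proof -
    obtain d where "d \<in> set (h # q')" "snd d = fst e"
      by (rule successively_pred[OF chains(1) e])
    then have "fst e \<in> C" using h q' by (metis set_ConsD)
    then show ?thesis using innerD[of e] e arcs(2) q' by blast
  qed
  then have "\<exists>q. q' = map (map_prod v v) q \<and> set q \<subseteq> parcs (crown n)"
  proof (induction q')
    case (Cons e q')
    then obtain q d where "q' = map (map_prod v v) q" "set q \<subseteq> parcs (crown n)"
      "d \<in> parcs (crown n)" "e = map_prod v v d"
      by (meson list.set_intros)
    then have "e # q' = map (map_prod v v) (d # q) \<and> set (d # q) \<subseteq> parcs (crown n)" by simp
    then show ?case by (rule exI[of _ "d # q"])
  qed simp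
  then obtain q where q: "q' = map (map_prod v v) q" "set q \<subseteq> parcs (crown n)" by blast
  \<comment> \<open>A re-entry would be a second incoming edge, equal to \<open>h\<close> by
    \<open>incoming_unique\<close>, whereas the arcs of the cycle are distinct.\<close>
  have r_heads: "snd e \<notin> C" if "e \<in> set r" for e
  proof
    assume "snd e \<in> C"
    then have "\<exists>e\<in>set r. snd e \<in> C" using that by blast
    then obtain r1 e r2 where r: "r = r1 @ e # r2" "snd e \<in> C" "\<forall>e\<in>set r1. snd e \<notin> C"
      using split_list_first_prop[of r "\<lambda>e. snd e \<in> C"] by blast
    have "snd (last (g # r1)) = fst e"
      using chains(3) successively_append_iff[of _ "g # r1" "e # r2"] r(1) by simp
    then have "fst e \<notin> C" using r(3) g last_in_set[of "g # r1"]
      by (metis list.distinct(1) set_ConsD)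
    moreover have "e \<in> parcs G" using r(1) arcs(3) by simp
    ultimately obtain i' where i': "i' \<in> {1..n}" "e = inc i'" using incD r(2) by blast
    have "e \<in> set p" using p2(2) p2_eq r(1) by auto
    then have "e = h" using incoming_unique i i' h_p by blast
    moreover have "distinct p2"
      using p_distinct rot distinct_map by (metis distinct_rotate)
    ultimately show False unfolding p2_eq r(1) by auto
  qed
  have r_out: "\<forall>e\<in>set r. fst e \<notin> C \<and> snd e \<notin> C"
  proof
    fix e assume e: "e \<in> set r"
    obtain d where "d \<in> set (g # r)" "snd d = fst e"
      by (rule successively_pred[OF chains(3) e])
    then show "fst e \<notin> C \<and> snd e \<notin> C" using g r_heads e by (metis set_ConsD)
  qed
  have "rotate (length as + length xs) p = inc i # map (map_prod v v) q @ outg j # r"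
    unfolding rot p2_eq i(2) q(1) j(2) ..
  from i(1) j(1) this q(2) r_out show thesis by (rule that)
qed

text \<open>The inner block of \<open>traverse\<close>, pulled back along \<open>v\<close>, visits
  every crown vertex once, so the analysis of traversals applies to it and identifies the exit
  label.\<close>

lemma crown_passage:
  obtains i q where "i \<in> {1..n}"
    "set p \<inter> inc ` {1..n} = {inc i}" "set p \<inter> outg ` {1..n} = {outg i}"
    "follows_between p (inc i) (map (map_prod v v) q) (outg i)"
    "set q \<subseteq> parcs (crown n)" "pcas (2*i - 1) q (crown_tail a b i)"
    "distinct ((2*i - 1) # map snd q)" "set ((2*i - 1) # map snd q) = {1..N}"
proof -
  obtain i j k q r where i: "i \<in> {1..n}" and j: "j \<in> {1..n}"
    and rot: "rotate k p = inc i # map (map_prod v v) q @ outg j # r"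
    and q: "set q \<subseteq> parcs (crown n)"
    and r: "\<forall>e\<in>set r. fst e \<notin> C \<and> snd e \<notin> C"
    by (rule traverse)
  define w where "w = (2*i - 1) # map snd q"
  have p_eq: "set p = set (inc i # map (map_prod v v) q @ outg j # r)"
    unfolding rot[symmetric] by simp
  have qV: "set q \<subseteq> {1..N} \<times> {1..N}" using q arc_crown by blast
  have start: "2*i - 1 \<in> {1..N}" using i n N by auto
  have tail: "crown_tail a b j \<in> {1..N}" using crown_tail_bounds j n N by simp
  have "cyclic_chain (rotate k p)"
    unfolding rotate_drop_take by (rule cyclic_chain_swap) (simp add: p_chain)
  then have "successively (\<lambda>e f. snd e = fst f) ((inc i # map (map_prod v v) q @ [outg j]) @ r)"
    unfolding cyclic_chain_def rot by simp
  then have "successively (\<lambda>e f. snd e = fst f) (inc i # map (map_prod v v) q @ [outg j])"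
    unfolding successively_append_iff by blast
  then have path: "pcas (2*i - 1) q (crown_tail a b j)"
    by (rule pcas_pullback[OF _ inc_heads[OF i] out_tails[OF j] v start tail qV])
  have "distinct (map snd (rotate k p))"
    unfolding rotate_map[symmetric] using p_distinct by simp
  then have "distinct (map v w)"
    unfolding rot w_def using inc_heads[OF i] by (simp add: comp_def)
  then have dist: "distinct w" by (rule distinct_map[THEN iffD1, THEN conjunct1])
  have w_sub: "set w \<subseteq> {1..N}" unfolding w_def using start qV by auto
  \<comment> \<open>Every vertex is the head of some arc of the cycle, and the arcs from
    \<open>outg j\<close> on have heads outside the crown.\<close>
  have "x \<in> set w" if x: "x \<in> {1..N}" for x
  proof -
    have vx: "v x \<in> C" using x by (rule imageI)
    then have "v x \<in> snd ` set p" using verts p_heads by blast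
    then obtain e where e: "e \<in> set p" "v x = snd e" by (rule imageE)
    then have "e = inc i \<or> e \<in> map_prod v v ` set q"
      using p_eq r vx outg_outside[OF j] by auto
    then have "v x \<in> v ` set w"
    proof
      assume "e = inc i"
      then show ?thesis unfolding w_def e(2) using inc_heads[OF i] by simp
    next
      assume "e \<in> map_prod v v ` set q"
      then obtain d where d: "e = map_prod v v d" "d \<in> set q" by (rule imageE)
      then have "snd d \<in> set w" unfolding w_def by simp
      then show ?thesis unfolding e(2) d(1) by simp
    qed
    then obtain y where "y \<in> set w" "v x = v y" by (rule imageE)
    then show ?thesis using v_inj[of x y] x w_sub by blast
  qed
  then have cover: "set w = {1..N}" using w_sub by blast
  have "successively (crown_arc a b) w"
    unfolding w_def by (rule pcas_successively[OF path]) (use q arc_crown in blast)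
  moreover have last: "last w = crown_tail a b j" unfolding w_def by (rule pcas_last[OF path])
  moreover have "crown_exit a b (crown_tail a b j)" using crown_exit_tail j n by simp
  \<comment> \<open>Taking \<open>w\<close> for both lists extracts the statement about the last
    vertex; \<open>crown_tail_inj\<close> then gives \<open>j = i\<close>.\<close>
  ultimately have "last w = crown_tail a b i"
    using crown_list_unique(2)[OF n N, of i w w] i dist cover by (simp add: w_def)
  then have ji: "j = i"
    using last inj_onD[OF crown_tail_inj, of a b j i] i j n by simp
  have "inc l = inc i" if "l \<in> {1..n}" "inc l \<in> set p" for l
    using incoming_unique[of l i] that i p_eq by simp
  moreover have "inc i \<in> set p" "outg i \<in> set p" unfolding p_eq ji by simp_all
  moreover have "outg l = outg i" if l: "l \<in> {1..n}" "outg l \<in> set p" for l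
  proof -
    have "outg l \<noteq> inc i" using outg_inside[OF l(1)] inc_outside[OF i] by metis
    moreover have "outg l \<notin> map_prod v v ` set q"
      using outg_outside[OF l(1)] qV by auto
    moreover have "outg l \<notin> set r" using r outg_inside[OF l(1)] by blast
    ultimately show ?thesis using l(2) unfolding p_eq ji by auto
  qed
  ultimately have "set p \<inter> inc ` {1..n} = {inc i}" "set p \<inter> outg ` {1..n} = {outg i}"
    using i by blast+
  moreover have "follows_between p (inc i) (map (map_prod v v) q) (outg i)"
    unfolding follows_between_def using rot ji by blast
  ultimately show thesis
    using that[OF i _ _ _ q] path dist cover unfolding ji w_def by blast
qed

end

text \<open>Both vertex lists are traversals from \<open>2i - 1\<close> to an exit, hence equal, and
  a path is determined by its vertices.\<close>

lemma crown_path_unique: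
  assumes i: "i \<in> {1..n}"
    and q: "set q \<subseteq> parcs (crown n)" "pcas (2*i - 1) q (crown_tail a b i)"
      "distinct ((2*i - 1) # map snd q)" "set ((2*i - 1) # map snd q) = {1..N}"
    and q': "set q' \<subseteq> parcs (crown n)" "pcas (2*i - 1) q' (crown_tail a b i)"
      "distinct ((2*i - 1) # map snd q')" "set ((2*i - 1) # map snd q') = {1..N}"
  shows "q = q'"
proof -
  have exit: "crown_exit a b (crown_tail a b i)" using crown_exit_tail i n by simp
  have arcs: "successively (crown_arc a b) ((2*i - 1) # map snd q)"
    if "set q \<subseteq> parcs (crown n)" "pcas (2*i - 1) q (crown_tail a b i)" for q
    by (rule pcas_successively[OF that(2)]) (use that(1) arc_crown in blast)
  have "(2*i - 1) # map snd q = (2*i - 1) # map snd q'"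
    using crown_list_unique(1)[OF n N _ _ q(3,4) _ arcs[OF q(1,2)] _ q'(3,4) _ arcs[OF q'(1,2)]]
      i exit by (simp only: pcas_last[OF q(2)] pcas_last[OF q'(2)] list.sel atLeastAtMost_iff)
  then show ?thesis using pcas_unique[OF q(2) q'(2)] by simp
qed

end

section \<open>Specialising \<open>a\<close> and \<open>b\<close> to the crown of the
  theorem\<close>

lemma parcs_crown_subset:
  assumes n: "n = a + b + 4" and ab: "(n - 3) div 2 = a" "(n - 4) div 2 = b"
    and N: "N = 5*a + 5*b + 10"
  shows "parcs (crown n) \<subseteq> {(x, y). x \<in> {1..N} \<and> y \<in> {1..N} \<and> crown_arc a b x y}"
proof
  fix e assume e: "e \<in> parcs (crown n)"
  obtain x y where xy: "e = (x, y)" by (cases e)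
  consider i where "i \<in> {1..N - 1}" "x = i" "y = i + 1"
    | i where "i \<in> {1..N - 1}" "x = i + 1" "y = i"
    | "x = 1" "y = N" | "x = N" "y = 1"
    | "x = 2*n" "y = 2*n - 2" | "x = N" "y = 2"
    | i where "i \<in> {1..a}" "x = 2*n + 3*i" "y = 2*n - 2 - 2*i"
    | i where "i \<in> {1..b}" "x = N - 3*i" "y = 2*i + 2"
  proof -
    have "5*n - 10 = N" "5*n - 11 = N - 1" using n N by simp_all
    then show thesis using e that unfolding xy crown_def ab by auto
  qed
  then have "x \<in> {1..N} \<and> y \<in> {1..N} \<and> crown_arc a b x y"
  proof cases
    case 5
    then have "x = 2*a + 2*b + 8 + 3*0" "y + 2*0 = 2*a + 2*b + 6" using n by simp_all
    then show ?thesis unfolding crown_arc_def N by auto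
  next
    case 6
    then have "x + 3*0 = 5*a + 5*b + 10" "y = 2*0 + 2" using N by simp_all
    then show ?thesis unfolding crown_arc_def N by auto
  next
    case (7 i)
    then have "i \<le> a" "x = 2*a + 2*b + 8 + 3*i" "y + 2*i = 2*a + 2*b + 6" using n by auto
    then show ?thesis unfolding crown_arc_def N by auto
  next
    case (8 i)
    then have "i \<le> b" "x + 3*i = 5*a + 5*b + 10" "y = 2*i + 2" using N by auto
    then show ?thesis unfolding crown_arc_def N by auto
  qed (use N in \<open>auto simp: crown_arc_def\<close>)
  then show "e \<in> {(x, y). x \<in> {1..N} \<and> y \<in> {1..N} \<and> crown_arc a b x y}" using xy by simp
qed

text \<open>The heads \<open>v (2*i - 1)\<close> and the prescribed tails are pairwise distinct, so
  each of \<open>inc\<close> and \<open>outg\<close> enumerates exactly \<open>n\<close> edges and a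
  common index means a common label.\<close>

theorem theorem1:
  fixes n :: nat
    and G :: "'a pair_pre_digraph"
    and v :: "nat \<Rightarrow> 'a"  \<comment> \<open>\<open>v k\<close> is the vertex of \<open>G\<close> named \<open>k\<close>, for \<open>1 \<le> k \<le> 5n - 10\<close>\<close>
    and C :: "'a set"
    and inc outg :: "nat \<Rightarrow> 'a \<times> 'a"
  assumes n: "n \<ge> 4"
    and G: "pair_wf_digraph G"
    and v: "inj_on v (pverts (crown n))"
    and C: "C = v ` pverts (crown n)"
    and verts: "C \<subset> pverts G"
    and inner: "{(x, y) \<in> parcs G. x \<in> C \<and> y \<in> C} = map_prod v v ` parcs (crown n)"
    and incoming: "{(x, y) \<in> parcs G. x \<notin> C \<and> y \<in> C} = inc ` {1..n}"
    and inc_heads: "\<forall>i\<in>{1..n}. snd (inc i) = v (2*i - 1)"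
    and outgoing: "{(x, y) \<in> parcs G. x \<in> C \<and> y \<notin> C} = outg ` {1..n}"
    and out_tails:
      "fst (outg 1) = v (5*n - 10)"
      "fst (outg 2) = v 1"
      "fst (outg (n - 1)) = v (2*n - 1)"
      "fst (outg n) = v (2*n)"
      "\<forall>i\<in>{1..(n - 4) div 2}. fst (outg (i + 2)) = v (5*n - 9 - 3*i)"
      "\<forall>i\<in>{1..(n - 3) div 2}. fst (outg (n - 1 - i)) = v (2*n - 1 + 3*i)"
  shows
    "(\<forall>p. pre_digraph.hamiltonian_cycle (with_proj G) p \<longrightarrow>
        (\<exists>i\<in>{1..n}. set p \<inter> inc ` {1..n} = {inc i} \<and> set p \<inter> outg ` {1..n} = {outg i}))
     \<and>
     (\<forall>i\<in>{1..n}. \<forall>p p'.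
        pre_digraph.hamiltonian_cycle (with_proj G) p \<and> inc i \<in> set p \<and>
        pre_digraph.hamiltonian_cycle (with_proj G) p' \<and> inc i \<in> set p' \<longrightarrow>
        (\<exists>q t. pre_digraph.apath (with_proj (crown n)) (2*i - 1) q t \<and> v t = fst (outg i) \<and>
           follows_between p (inc i) (map (map_prod v v) q) (outg i) \<and>
           follows_between p' (inc i) (map (map_prod v v) q) (outg i)))"
proof -
  define a b N where "a = (n - 3) div 2" and "b = (n - 4) div 2" and "N = 5*n - 10"
  have n': "n = a + b + 4" using n unfolding a_def b_def by presburger
  then have N': "N = 5*a + 5*b + 10" unfolding N_def by simp
  have V: "pverts (crown n) = {1..N}" by (simp add: crown_def N_def)
  \<comment> \<open>Merges the six clauses into \<open>crown_tail\<close>: labels in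
    \<open>3..b + 2\<close> use the first indexed clause at \<open>i - 2\<close>, labels in
    \<open>b + 3..n - 2\<close> the second at \<open>n - 1 - i\<close>.\<close>
  have tails: "fst (outg i) = v (crown_tail a b i)" if "i \<in> {1..n}" for i
  proof -
    have "1 \<le> i" "i \<le> n" using that by simp_all
    then consider "i = 1" | "i = 2" | "i = n" | "i = n - 1" "2 < i" | "2 < i" "i \<le> b + 2"
      | "b + 2 < i" "i < n - 1"
      by linarith
    then show ?thesis
    proof cases
      case 1
      then have "crown_tail a b i = 5*n - 10" using n' by (simp add: crown_tail_def)
      then show ?thesis using out_tails(1) 1 by simp
    next
      case 2
      then show ?thesis using out_tails(2) by (simp add: crown_tail_def)
    next
      case 3
      then have "crown_tail a b i = 2*n" using n' by (simp add: crown_tail_def)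
      then show ?thesis using out_tails(4) 3 by simp
    next
      case 4
      then have "crown_tail a b i = 2*n - 1" using n' by (simp add: crown_tail_def)
      then show ?thesis using out_tails(3) 4(1) by simp
    next
      case 5
      then have "1 \<le> i - 2" "i - 2 \<le> b" by linarith+
      then have "i - 2 \<in> {1..(n - 4) div 2}" unfolding b_def by simp
      with out_tails(5) have "fst (outg (i - 2 + 2)) = v (5*n - 9 - 3*(i - 2))" by blast
      moreover have "crown_tail a b i = 5*n - 9 - 3*(i - 2)"
        using 5 n' by (simp add: crown_tail_def)
      moreover have "i - 2 + 2 = i" using 5 by simp
      ultimately show ?thesis by metis
    next
      case 6
      then have "1 \<le> n - 1 - i" "n - 1 - i \<le> a" using n' by linarith+
      then have "n - 1 - i \<in> {1..(n - 3) div 2}" unfolding a_def by simp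
      with out_tails(6) have "fst (outg (n - 1 - (n - 1 - i))) = v (2*n - 1 + 3*(n - 1 - i))" by blast
      moreover have "crown_tail a b i = 2*n - 1 + 3*(n - 1 - i)"
        using 6 n' by (simp add: crown_tail_def)
      moreover have "n - 1 - (n - 1 - i) = i" using 6 by simp
      ultimately show ?thesis by metis
    qed
  qed
  interpret crown_in_graph a b n N G v inc outg
  proof
    show "parcs (crown n) \<subseteq> {(x, y). x \<in> {1..N} \<and> y \<in> {1..N} \<and> crown_arc a b x y}"
      by (rule parcs_crown_subset[OF n' a_def[symmetric] b_def[symmetric] N'])
  qed (fact n' N' v[unfolded V] verts[unfolded C V] inner[unfolded C V]
      incoming[unfolded C V] inc_heads[rule_format] outgoing[unfolded C V] tails)+
  have wf: "2*i - 1 \<in> pverts (crown n)" if "i \<in> {1..n}" for i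
    using that n' N' unfolding V by auto
  show ?thesis
  proof (intro conjI allI impI ballI)
    fix p assume "pre_digraph.hamiltonian_cycle (with_proj G) p"
    then obtain i where "i \<in> {1..n}" "set p \<inter> inc ` {1..n} = {inc i}"
      "set p \<inter> outg ` {1..n} = {outg i}"
      by (rule crown_passage)
    then show "\<exists>i\<in>{1..n}. set p \<inter> inc ` {1..n} = {inc i} \<and> set p \<inter> outg ` {1..n} = {outg i}"
      by blast
  next
    fix i p p'
    assume i: "i \<in> {1..n}"
      and hams: "pre_digraph.hamiltonian_cycle (with_proj G) p \<and> inc i \<in> set p \<and>
        pre_digraph.hamiltonian_cycle (with_proj G) p' \<and> inc i \<in> set p'"
    have passage: "\<exists>q. follows_between p (inc i) (map (map_prod v v) q) (outg i) \<and>
        set q \<subseteq> parcs (crown n) \<and> pcas (2*i - 1) q (crown_tail a b i) \<and>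
        distinct ((2*i - 1) # map snd q) \<and> set ((2*i - 1) # map snd q) = {1..N}"
      if p: "pre_digraph.hamiltonian_cycle (with_proj G) p" "inc i \<in> set p" for p
    proof -
      obtain j q where j: "j \<in> {1..n}" "set p \<inter> inc ` {1..n} = {inc j}"
        and q: "follows_between p (inc j) (map (map_prod v v) q) (outg j)"
          "set q \<subseteq> parcs (crown n)" "pcas (2*j - 1) q (crown_tail a b j)"
          "distinct ((2*j - 1) # map snd q)" "set ((2*j - 1) # map snd q) = {1..N}"
        by (rule crown_passage[OF p(1)])
      have "inc j \<in> set p" using j(2) by blast
      then have "j = i" using incoming_unique[OF p(1) j(1) i _ p(2)] by blast
      with q show ?thesis by blast
    qed
    obtain q where q: "follows_between p (inc i) (map (map_prod v v) q) (outg i)"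
        "set q \<subseteq> parcs (crown n)" "pcas (2*i - 1) q (crown_tail a b i)"
        "distinct ((2*i - 1) # map snd q)" "set ((2*i - 1) # map snd q) = {1..N}"
      using passage[of p] hams by blast
    obtain q' where q': "follows_between p' (inc i) (map (map_prod v v) q') (outg i)"
        "set q' \<subseteq> parcs (crown n)" "pcas (2*i - 1) q' (crown_tail a b i)"
        "distinct ((2*i - 1) # map snd q')" "set ((2*i - 1) # map snd q') = {1..N}"
      using passage[of p'] hams by blast
    have "q' = q" by (rule crown_path_unique[OF i q'(2-5) q(2-5)])
    moreover have "pre_digraph.apath (with_proj (crown n)) (2*i - 1) q (crown_tail a b i)"
      using wf[OF i] q(2-4) pawalk_verts_pcas[OF q(3)]
      unfolding pre_digraph.apath_def pre_digraph.awalk_def cas_with_proj_eq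
        awalk_verts_with_proj_eq with_proj_simps by simp
    ultimately show "\<exists>q t. pre_digraph.apath (with_proj (crown n)) (2*i - 1) q t \<and> v t = fst (outg i) \<and>
        follows_between p (inc i) (map (map_prod v v) q) (outg i) \<and>
        follows_between p' (inc i) (map (map_prod v v) q) (outg i)"
      using q(1) q'(1) tails[OF i] by metis
  qed
qed

end
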